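(* For $H<0$ let $\Sigma_{H,-1/H}$ be the axially symmetric constant mean curvature surface in $S^3$ with parameters $H$ and $C=-\frac1H$. Then: (a) For every $H<0$, the surface $\Sigma_{H,-1/H}$ is not embedded. (b) For every $H<0$, the profile curve of $\Sigma_{H,-1/H}$ contains the origin of $\mathbb{R}^2$, and therefore $\Sigma_{H,-1/H}$ contains a circle of radius $1$. (c) For every integer $m>2$ there exists $H<0$ such that the profile curve of $\Sigma_{H,-1/H}$ is invariant under the cyclic group $Z_m$.
   Context: $S^3$ is the unit sphere in $\mathbb{R}^4$. For $H\in\mathbb{R}$ and $C>2(H+\sqrt{1+H^2})$ (which holds for $H<0$, $C=-1/H$) put $T=\frac{\pi}{\sqrt{1+H^2}}$ and $$g(t)=\sqrt{\frac{C-2H}{2+2H^2}+\frac{\sqrt{C^2-4CH-4}}{2+2H^2}\sin(2\sqrt{1+H^2}\,t)},$$ a positive $T$-periodic function satisfying $g'^2+g^2(1+(H+g^{-2})^2)=C$. Let $$\theta(t)=\int_{T/4}^{t}\frac{\sqrt{C}\,g(\tau)\,(H-g(\tau)^{-2})}{g'(\tau)^2+g(\tau)^2}\,d\tau$$ and let $\beta:\mathbb{R}\to\mathbb{R}^2$ be $$\beta=\frac{1}{\sqrt{C g'^2+Cg^2}}\Big(-\sqrt{C}\,g'\cos\theta-(Hg^2+1)\sin\theta,\ \sqrt{C}\,g'\sin\theta-(Hg^2+1)\cos\theta\Big).$$ The surface $\Sigma_{H,C}$ is the one given by the immersion $\phi:\mathbb{R}^2\to S^3$, $$\phi(s,t)=\big(\sqrt{1-|\beta(t)|^2}\cos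 s,\ \sqrt{1-|\beta(t)|^2}\sin s,\ \beta(t)\big);$$ $\beta$ (or its image $\beta(\mathbb{R})\subset\mathbb{R}^2$) is called its profile curve. $\Sigma_{H,C}$ is embedded if its image $\phi(\mathbb{R}^2)$ is an embedded two-dimensional smooth submanifold of $S^3$. The profile curve is invariant under $Z_m$ if the set $\beta(\mathbb{R})$ is invariant under the rotation of $\mathbb{R}^2$ about the origin by angle $2\pi/m$. *)

theory Defs
  imports "HOL-Analysis.Analysis"
begin

section \<open>Embedded surfaces in a subset of Euclidean space\<close>

text \<open>\<open>Ck_on n f S\<close> is the usual notion of class \<open>C\<^sup>n\<close> when \<open>S\<close> is open, and is only used then.\<close>

primrec Ck_on ::
  "nat \<Rightarrow> ('a::euclidean_space \<Rightarrow> 'b::euclidean_space) \<Rightarrow> 'a set \<Rightarrow> bool" where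
  "Ck_on 0 f S \<longleftrightarrow> continuous_on S f"
| "Ck_on (Suc n) f S \<longleftrightarrow>
     (\<forall>x\<in>S. f differentiable (at x)) \<and>
     (\<forall>v. Ck_on n (\<lambda>x. frechet_derivative f (at x) v) S)"

text \<open>Smoothness of a map defined on an arbitrary subset of a Euclidean space: locally it is
  the restriction of a smooth map defined on an open set of the ambient space.\<close>

definition smooth_map_on ::
  "'a::euclidean_space set \<Rightarrow> ('a \<Rightarrow> 'b::euclidean_space) \<Rightarrow> bool" where
  "smooth_map_on A f \<longleftrightarrow>
     (\<forall>x\<in>A. \<exists>W F. open W \<and> x \<in> W \<and> (\<forall>n. Ck_on n F W) \<and> (\<forall>y\<in>A \<inter> W. F y = f y))"

definition diffeomorphism_between ::
  "'a::euclidean_space set \<Rightarrow> 'b::euclidean_space set \<Rightarrow> ('a \<Rightarrow> 'b) \<Rightarrow> bool" where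
  "diffeomorphism_between A B f \<longleftrightarrow>
     bij_betw f A B \<and> smooth_map_on A f \<and> smooth_map_on B (inv_into A f)"

text \<open>The slice-chart definition of an embedded two-dimensional smooth submanifold \<open>M\<close> of a smooth
  three-dimensional submanifold \<open>N\<close> of \<open>\<real>\<^sup>4\<close> (below, \<open>N\<close> is the unit sphere): around each point of
  \<open>M\<close> there is a smooth chart of \<open>N\<close> that flattens \<open>M\<close> onto a coordinate plane.\<close>

definition embedded_surface_in :: "(real^4) set \<Rightarrow> (real^4) set \<Rightarrow> bool" where
  "embedded_surface_in N M \<longleftrightarrow> M \<subseteq> N \<and>
     (\<forall>p\<in>M. \<exists>U (V :: (real^3) set) \<kappa>.
        openin (top_of_set N) U \<and> p \<in> U \<and> open V \<and>
        diffeomorphism_between U V \<kappa> \<and>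
        \<kappa> ` (U \<inter> M) = {x \<in> V. x $ 3 = 0})"


section \<open>The axially symmetric surfaces\<close>

definition period :: "real \<Rightarrow> real" where
  "period H = pi / sqrt (1 + H\<^sup>2)"

definition g_fun :: "real \<Rightarrow> real \<Rightarrow> real \<Rightarrow> real" where
  "g_fun H C t =
     sqrt ((C - 2 * H) / (2 + 2 * H\<^sup>2)
           + sqrt (C\<^sup>2 - 4 * C * H - 4) / (2 + 2 * H\<^sup>2) * sin (2 * sqrt (1 + H\<^sup>2) * t))"

text \<open>The interval integral is oriented: it changes sign when its bounds are exchanged, so that
  the following is also right for \<open>t < period H / 4\<close>.\<close>

definition theta :: "real \<Rightarrow> real \<Rightarrow> real \<Rightarrow> real" where
  "theta H C t =
     (LBINT \<tau>=ereal (period H / 4)..ereal t.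
        sqrt C * g_fun H C \<tau> * (H - 1 / (g_fun H C \<tau>)\<^sup>2)
        / ((deriv (g_fun H C) \<tau>)\<^sup>2 + (g_fun H C \<tau>)\<^sup>2))"

definition profile :: "real \<Rightarrow> real \<Rightarrow> real \<Rightarrow> real^2" where
  "profile H C t =
     (let g = g_fun H C t; g' = deriv (g_fun H C) t; \<theta> = theta H C t
      in (1 / sqrt (C * g'\<^sup>2 + C * g\<^sup>2)) *\<^sub>R
         vector [- sqrt C * g' * cos \<theta> - (H * g\<^sup>2 + 1) * sin \<theta>,
                 sqrt C * g' * sin \<theta> - (H * g\<^sup>2 + 1) * cos \<theta>])"

definition immersion :: "real \<Rightarrow> real \<Rightarrow> real \<times> real \<Rightarrow> real^4" where
  "immersion H C = (\<lambda>(s, t).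
     vector [sqrt (1 - (norm (profile H C t))\<^sup>2) * cos s,
             sqrt (1 - (norm (profile H C t))\<^sup>2) * sin s,
             profile H C t $ 1,
             profile H C t $ 2])"

definition profile_curve :: "real \<Rightarrow> real \<Rightarrow> (real^2) set" where
  "profile_curve H C = range (profile H C)"

definition cmc_surface :: "real \<Rightarrow> real \<Rightarrow> (real^4) set" where
  "cmc_surface H C = range (immersion H C)"

definition embedded_in_S3 :: "real \<Rightarrow> real \<Rightarrow> bool" where
  "embedded_in_S3 H C \<longleftrightarrow> embedded_surface_in (sphere 0 1) (cmc_surface H C)"


section \<open>Rotations and circles\<close>

definition rotation :: "real \<Rightarrow> real^2 \<Rightarrow> real^2" where
  "rotation \<alpha> x =
     vector [cos \<alpha> * x $ 1 - sin \<alpha> * x $ 2, sin \<alpha> * x $ 1 + cos \<alpha> * x $ 2]"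

definition invariant_under_Z :: "nat \<Rightarrow> (real^2) set \<Rightarrow> bool" where
  "invariant_under_Z m S \<longleftrightarrow> rotation (2 * pi / real m) ` S = S"

definition is_circle :: "real \<Rightarrow> 'a::real_inner set \<Rightarrow> bool" where
  "is_circle r K \<longleftrightarrow> (\<exists>c u v. norm u = 1 \<and> norm v = 1 \<and> u \<bullet> v = 0 \<and>
     K = range (\<lambda>s. c + (r * cos s) *\<^sub>R u + (r * sin s) *\<^sub>R v))"

end

theory Submission
  imports Defs
begin

text \<open>With \<open>h = - H\<close>, \<open>\<omega> = sqrt (1 + h\<^sup>2)\<close> and \<open>x = \<omega> * t - pi / 4\<close> the profile curve has the polar form
  \<open>(sin x / \<omega>) * (cos (\<Phi> x), sin (\<Phi> x))\<close>, where \<open>\<Phi>\<close> is the integral of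
  \<open>h / sqrt (h\<^sup>2 + (cos v)\<^sup>2)\<close> from \<open>0\<close>. It passes through the origin at \<open>x = 0\<close> and \<open>x = pi\<close>, with
  directions that enclose the angle \<open>K = \<Phi> pi\<close>. Since \<open>0 < K < pi\<close>, the surface has velocities that span
  all three dimensions tangent to the sphere at a point of the unit circle over the origin, so it
  is not embedded. Over one period the curve is rotated by \<open>pi + K\<close>; as \<open>h\<close> runs through the positive
  reals, \<open>K\<close> is continuous and tends to \<open>0\<close> at \<open>0\<close> and to \<open>pi\<close> at infinity, so it takes the value
  \<open>pi - 2 * pi / m\<close> for every \<open>m > 2\<close>.\<close>

lemma interval_integral_has_real_derivative:
  fixes f :: "real \<Rightarrow> real"
  assumes "\<And>x. isCont f x"
  shows "((\<lambda>u. LBINT y=ereal c..ereal u. f y) has_real_derivative f x) (at x)"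
proof -
  \<comment> \<open>The margins of \<open>1\<close> put \<open>x\<close> in the interior of an
    interval that also contains \<open>c\<close>, so the one-sided rule yields a two-sided
    derivative on either side of \<open>c\<close>.\<close>
  define a b where "a = min c x - 1" and "b = max c x + 1"
  have "((\<lambda>u. LBINT y=ereal c..ereal u. f y) has_vector_derivative f x) (at x within {a..b})"
    by (rule interval_integral_FTC2)
      (auto simp: a_def b_def intro!: continuous_at_imp_continuous_on assms)
  moreover have "x \<in> interior {a..b}"
    by (auto simp: a_def b_def)
  ultimately show ?thesis
    by (metis at_within_interior has_real_derivative_iff_has_vector_derivative)
qed

section \<open>Tangent directions of embedded surfaces\<close>

lemma has_vector_derivative_vecI:
  fixes f :: "real \<Rightarrow> real^'n"
  assumes "\<And>i. ((\<lambda>t. f t $ i) has_real_derivative v $ i) (at x)"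
  shows "(f has_vector_derivative v) (at x)"
  unfolding has_vector_derivative_def has_derivative_componentwise_within[of f]
  using assms
  by (auto simp: Basis_vec_def inner_axis has_field_derivative_def mult_commute_abs)

lemma vector_derivative_unique_eventually:
  assumes "(f has_vector_derivative f') (at x)" "(g has_vector_derivative g') (at x)"
    and "\<forall>\<^sub>F y in nhds x. f y = g y"
  shows "f' = g'"
proof -
  obtain S where "open S" "x \<in> S" "\<And>y. y \<in> S \<Longrightarrow> f y = g y"
    using assms(3) by (auto simp: eventually_nhds)
  then have "(g has_vector_derivative f') (at x)"
    by (rule has_vector_derivative_transform_within_open[OF assms(1)])
  then show ?thesis
    using assms(2) by (rule vector_derivative_unique_at)
qed

lemma vector_4:
  "(vector [a, b, c, d] :: 'a::zero^4) $ 1 = a" "(vector [a, b, c, d] :: 'a::zero^4) $ 2 = b"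
  "(vector [a, b, c, d] :: 'a::zero^4) $ 3 = c" "(vector [a, b, c, d] :: 'a::zero^4) $ 4 = d"
  unfolding vector_def by (simp_all add: eval_nat_numeral)

text \<open>Curves need a derivative at \<open>0\<close> only. Where several sheets cross, this set
  collects the directions of all of them and need not be a subspace.\<close>

definition tangent_cone :: "'a::real_normed_vector set \<Rightarrow> 'a \<Rightarrow> 'a set" where
  "tangent_cone M p =
    {v. \<exists>\<gamma>. \<gamma> 0 = p \<and> range \<gamma> \<subseteq> M \<and> (\<gamma> has_vector_derivative v) (at (0::real))}"

lemma smooth_map_onE:
  assumes "smooth_map_on A f" "x \<in> A"
  obtains W F F' where "open W" "x \<in> W" "(F has_derivative F') (at x)" "\<And>y. y \<in> A \<Longrightarrow> y \<in> W \<Longrightarrow> F y = f y"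
proof -
  obtain W F where W: "open W" "x \<in> W" "\<And>n. Ck_on n F W" "\<And>y. y \<in> A \<inter> W \<Longrightarrow> F y = f y"
    using assms unfolding smooth_map_on_def by metis
  obtain F' where "(F has_derivative F') (at x)"
    using W(2) W(3)[of "Suc 0"] unfolding Ck_on.simps differentiable_def by blast
  then show ?thesis
    using that[OF W(1,2)] W(4) by simp
qed

text \<open>The third component of a slice chart has a derivative that vanishes on every velocity of a curve
  in the surface, but not on the velocity of the third coordinate line of the inverse chart.\<close>

lemma embedded_surface_normal_direction:
  assumes emb: "embedded_surface_in (sphere 0 1) M" and p: "p \<in> M"
  obtains w where "w \<bullet> p = 0" "w \<notin> span (tangent_cone M p)"
proof -
  obtain U and V :: "(real^3) set" and \<kappa> where
    U: "openin (top_of_set (sphere 0 1)) U" "p \<in> U" and V: "open V"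
    and \<kappa>: "diffeomorphism_between U V \<kappa>" "\<kappa> ` (U \<inter> M) = {x \<in> V. x $ 3 = 0}"
    using bspec[OF conjunct2[OF emb[unfolded embedded_surface_in_def]] p] by blast
  have M: "M \<subseteq> sphere 0 1"
    using emb unfolding embedded_surface_in_def by blast
  define \<psi> where "\<psi> = inv_into U \<kappa>"
  have bij: "bij_betw \<kappa> U V" and s\<kappa>: "smooth_map_on U \<kappa>" and s\<psi>: "smooth_map_on V \<psi>"
    using \<kappa>(1) unfolding diffeomorphism_between_def \<psi>_def by blast+
  obtain Ob where Ob: "open Ob" "U = sphere 0 1 \<inter> Ob"
    using U(1) by (auto simp: openin_open)
  define y where "y = \<kappa> p"
  have y: "y \<in> V" "\<psi> y = p"
    using bij U(2) by (auto simp: y_def \<psi>_def bij_betw_def inv_into_f_f)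
  obtain W F L where W: "open W" "p \<in> W" "(F has_derivative L) (at p)" "\<And>z. z \<in> U \<Longrightarrow> z \<in> W \<Longrightarrow> F z = \<kappa> z"
    by (rule smooth_map_onE[OF s\<kappa> U(2)]) (rule that)
  obtain W' G N where W': "open W'" "y \<in> W'" "(G has_derivative N) (at y)" "\<And>z. z \<in> V \<Longrightarrow> z \<in> W' \<Longrightarrow> G z = \<psi> z"
    by (rule smooth_map_onE[OF s\<psi> y(1)]) (rule that)
  have Gy: "G y = p"
    using W'(2,4) y by simp
  define e :: "real^3" where "e = axis 3 1"
  define c where "c \<tau> = G (y + \<tau> *\<^sub>R e)" for \<tau> :: real
  have line: "((\<lambda>\<tau>. y + \<tau> *\<^sub>R e) has_vector_derivative e) (at 0)"
    by (auto intro!: derivative_eq_intros)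
  have c_deriv: "(c has_vector_derivative N e) (at 0)"
    using vector_derivative_diff_chain_within[OF line, of G N] W'(3)
    by (auto simp: c_def[abs_def] o_def intro: has_derivative_at_withinI)
  have c0: "c 0 = p" by (simp add: c_def Gy)
  have ev_line: "\<forall>\<^sub>F \<tau> in nhds 0. y + \<tau> *\<^sub>R e \<in> V \<inter> W'"
  proof -
    have "((\<lambda>\<tau>. y + \<tau> *\<^sub>R e) \<longlongrightarrow> y + 0 *\<^sub>R e) (nhds 0)"
      by (intro tendsto_intros filterlim_ident)
    moreover have "open (V \<inter> W')" using V W' by auto
    ultimately show ?thesis
      using y W' by (metis IntI add.right_neutral scaleR_zero_left topological_tendstoD)
  qed
  have ev_in: "\<forall>\<^sub>F \<tau> in nhds 0. \<gamma> \<tau> \<in> S"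
    if "(\<gamma> has_vector_derivative v) (at 0)" "open S" "\<gamma> 0 \<in> S" for \<gamma> :: "real \<Rightarrow> real^4" and v S
  proof -
    have "isCont \<gamma> 0"
      using that(1) by (rule has_vector_derivative_continuous)
    then have "(\<gamma> \<longlongrightarrow> \<gamma> 0) (nhds 0)"
      by (simp add: isCont_def tendsto_at_iff_tendsto_nhds)
    then show ?thesis
      using that(2,3) by (rule topological_tendstoD)
  qed
  \<comment> \<open>The extensions \<open>F\<close> and \<open>G\<close> need not be inverse to each
    other, but for small \<tau> the curve \<open>c\<close> agrees with the inverse chart, so it
    stays in \<open>U\<close>, where \<open>F\<close> is the chart.\<close>
  have ev_c: "\<forall>\<^sub>F \<tau> in nhds 0. c \<tau> \<in> sphere 0 1 \<and> F (c \<tau>) = y + \<tau> *\<^sub>R e"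
    using ev_line ev_in[OF c_deriv W(1), unfolded c0, OF W(2)]
  proof eventually_elim
    case (elim \<tau>)
    then have "c \<tau> = \<psi> (y + \<tau> *\<^sub>R e)" by (simp add: c_def W')
    moreover from this have "c \<tau> \<in> U"
      using elim bij by (auto simp: \<psi>_def bij_betw_def inv_into_into)
    ultimately show ?case
      using elim bij Ob W(4)[of "c \<tau>"] by (auto simp: \<psi>_def bij_betw_def f_inv_into_f)
  qed
  have chain: "((\<lambda>\<tau>. F (\<gamma> \<tau>)) has_vector_derivative L v) (at 0)"
    if "(\<gamma> has_vector_derivative v) (at 0)" "\<gamma> 0 = p" for \<gamma> v
    using vector_derivative_diff_chain_within[OF that(1), of F L] W(3) that(2)
    by (auto simp: o_def intro: has_derivative_at_withinI)
  have "L (N e) = e"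
    using vector_derivative_unique_eventually[OF chain[OF c_deriv c0] line] ev_c
    by (simp add: eventually_conj_iff)
  then have Lw: "L (N e) $ 3 = 1"
    by (simp add: e_def)
  \<comment> \<open>Since \<open>c\<close> stays on the unit sphere, its velocity \<open>N e\<close>
    is orthogonal to \<open>p\<close>.\<close>
  have "((\<lambda>\<tau>. c \<tau> \<bullet> c \<tau>) has_vector_derivative c 0 \<bullet> N e + N e \<bullet> c 0) (at 0)"
    by (rule bounded_bilinear.has_vector_derivative[OF bounded_bilinear_inner c_deriv c_deriv])
  moreover have "((\<lambda>\<tau>. 1::real) has_vector_derivative 0) (at 0)"
    by simp
  moreover have "\<forall>\<^sub>F \<tau> in nhds 0. c \<tau> \<bullet> c \<tau> = 1"
    using ev_c by eventually_elim (auto simp: dot_square_norm)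
  ultimately have "c 0 \<bullet> N e + N e \<bullet> c 0 = 0"
    by (rule vector_derivative_unique_eventually)
  then have normal: "N e \<bullet> p = 0"
    by (simp add: c0 inner_commute)
  have L: "linear L"
    using W(3) by (simp add: has_derivative_linear)
  have "L v $ 3 = 0" if v: "v \<in> tangent_cone M p" for v
  proof -
    obtain \<gamma> where \<gamma>: "\<gamma> 0 = p" "range \<gamma> \<subseteq> M" "(\<gamma> has_vector_derivative v) (at 0)"
      using v unfolding tangent_cone_def by blast
    have "p \<in> Ob" using U Ob by blast
    then have "\<forall>\<^sub>F \<tau> in nhds 0. \<gamma> \<tau> \<in> W \<inter> Ob"
      using ev_in[OF \<gamma>(3), of "W \<inter> Ob"] \<gamma>(1) W(1,2) Ob(1) by auto
    then have "\<forall>\<^sub>F \<tau> in nhds 0. F (\<gamma> \<tau>) $ 3 = 0"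
    proof eventually_elim
      case (elim \<tau>)
      have "\<gamma> \<tau> \<in> U \<inter> M"
        using elim \<gamma>(2) M Ob(2) by blast
      then have "\<kappa> (\<gamma> \<tau>) $ 3 = 0"
        using \<kappa>(2) by blast
      then show ?case
        using elim \<open>\<gamma> \<tau> \<in> U \<inter> M\<close> W(4) by simp
    qed
    moreover have "((\<lambda>\<tau>. F (\<gamma> \<tau>) $ 3) has_vector_derivative L v $ 3) (at 0)"
      by (rule bounded_linear.has_vector_derivative[OF bounded_linear_vec_nth chain[OF \<gamma>(3,1)]])
    ultimately show ?thesis
      using vector_derivative_unique_eventually[of "\<lambda>\<tau>. F (\<gamma> \<tau>) $ 3" "L v $ 3" 0 "\<lambda>_. 0" 0] by simp
  qed
  then have "tangent_cone M p \<subseteq> {v. L v $ 3 = 0}"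
    by blast
  moreover have "subspace {v. L v $ 3 = 0}"
    using L by (simp add: subspace_def linear_0 linear_add linear_cmul)
  ultimately have "span (tangent_cone M p) \<subseteq> {v. L v $ 3 = 0}"
    by (rule span_minimal)
  then have "N e \<notin> span (tangent_cone M p)"
    using Lw by auto
  with normal show ?thesis
    by (rule that)
qed

section \<open>Polar form of the profile curve\<close>

text \<open>Throughout, \<open>H = - h\<close> with \<open>h > 0\<close>, so that \<open>C = 1 / h\<close>, and \<open>x = freq h * t - pi / 4\<close>, so that
  \<open>t = T / 4\<close> becomes \<open>x = 0\<close> and the period \<open>T\<close> becomes \<open>pi\<close>.\<close>

definition freq :: "real \<Rightarrow> real" where
  "freq h = sqrt (1 + h\<^sup>2)"

definition radial :: "real \<Rightarrow> real \<Rightarrow> real" where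
  "radial h x = h\<^sup>2 + (cos x)\<^sup>2"

definition angle :: "real \<Rightarrow> real \<Rightarrow> real" where
  "angle h x = (LBINT v=ereal 0..ereal x. h / sqrt (radial h v))"

lemma freq_pos: "freq h > 0"
  by (simp add: freq_def add_pos_nonneg)

lemma freq_sq: "(freq h)\<^sup>2 = 1 + h\<^sup>2"
  by (simp add: freq_def add_nonneg_nonneg)

lemma angle_0: "angle h 0 = 0"
  by (simp add: angle_def)

context
  fixes h :: real
  assumes h: "h > 0"
begin

text \<open>The numerator of \<open>g'^2 + g^2\<close> in the variable \<open>x\<close>; see
  \<open>speed_eq\<close>.\<close>

definition speed_num :: "real \<Rightarrow> real" where
  "speed_num x = (freq h)\<^sup>2 * (cos x)\<^sup>2 * (sin x)\<^sup>2 + (radial h x)\<^sup>2"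

lemma radial_pos: "radial h x > 0"
  using h by (simp add: radial_def add_pos_nonneg)

lemma speed_num_pos: "speed_num x > 0"
  using radial_pos[of x] by (simp add: speed_num_def add_nonneg_pos)

text \<open>The right-hand side is the sum of the squared numerators of \<open>turn_sin\<close> and
  \<open>turn_cos\<close>, so these form a unit vector.\<close>

lemma speed_num_eq: "speed_num x = h\<^sup>2 * (sin x)\<^sup>2 * radial h x + (freq h)^4 * (cos x)\<^sup>2"
proof -
  have *: "(freq h)^4 = (1 + h\<^sup>2)\<^sup>2"
    using freq_sq by (metis power2_eq_square power4_eq_xxxx mult.assoc)
  show ?thesis
    unfolding speed_num_def * freq_sq radial_def cos_squared_eq by algebra
qed

lemma angle_deriv: "(angle h has_real_derivative h / sqrt (radial h x)) (at x)"
proof -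
  have "isCont (\<lambda>v. h / sqrt (radial h v)) v" for v
    using radial_pos[of v] by (auto simp: radial_def intro!: continuous_intros)
  then show ?thesis
    unfolding angle_def by (rule interval_integral_has_real_derivative)
qed

section \<open>The function \<open>g_fun\<close> and the derivative of \<open>theta\<close> in the
  variable \<open>x\<close>\<close>

lemma g_fun_eq:
  "g_fun (- h) (1 / h) = (\<lambda>t. sqrt (radial h (freq h * t - pi / 4)) / (sqrt h * freq h))"
proof
  fix t
  define c where "c = cos (freq h * t - pi / 4)"
  have "sin (2 * freq h * t) = cos (2 * (freq h * t - pi / 4))"
    by (simp add: cos_diff algebra_simps)
  also have "\<dots> = 2 * c\<^sup>2 - 1"
    unfolding c_def by (rule cos_double_cos)
  finally have s: "sin (2 * freq h * t) = 2 * c\<^sup>2 - 1" .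
  \<comment> \<open>This is what is special about \<open>C = - 1 / H\<close>: the term
    \<open>- 4 * C * H\<close> cancels the \<open>4\<close>, and the root becomes \<open>C\<close>
    itself.\<close>
  have "sqrt ((1 / h)\<^sup>2 - 4 * (1 / h) * (- h) - 4) = 1 / h"
    using h by (simp add: real_sqrt_divide power_divide)
  moreover have "(1 / h - 2 * - h) / (2 + 2 * (- h)\<^sup>2) + 1 / h / (2 + 2 * (- h)\<^sup>2) * (2 * c\<^sup>2 - 1)
      = (h\<^sup>2 + c\<^sup>2) / (h * (freq h)\<^sup>2)"
  proof -
    have "1 + h\<^sup>2 > 0" by (simp add: add_pos_nonneg)
    then show ?thesis
      unfolding freq_sq using h by (simp add: divide_simps) algebra
  qed
  moreover have "2 * sqrt (1 + (- h)\<^sup>2) * t = 2 * freq h * t"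
    by (simp add: freq_def)
  ultimately have "g_fun (- h) (1 / h) t = sqrt ((h\<^sup>2 + c\<^sup>2) / (h * (freq h)\<^sup>2))"
    unfolding g_fun_def by (simp only: s)
  then show "g_fun (- h) (1 / h) t = sqrt (radial h (freq h * t - pi / 4)) / (sqrt h * freq h)"
    using h freq_pos[of h] by (simp add: real_sqrt_divide real_sqrt_mult c_def radial_def)
qed

lemma deriv_g_fun:
  fixes t
  defines "x \<equiv> freq h * t - pi / 4"
  shows "deriv (g_fun (- h) (1 / h)) t = - (cos x * sin x) / (sqrt h * sqrt (radial h x))"
proof -
  have "radial h x > 0" by (rule radial_pos)
  then have "(g_fun (- h) (1 / h) has_real_derivative
      - (cos x * sin x) / (sqrt h * sqrt (radial h x))) (at t)"
    unfolding g_fun_eq radial_def x_def using h freq_pos[of h]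
    by (auto intro!: derivative_eq_intros simp: divide_simps)
  then show ?thesis by (rule DERIV_imp_deriv)
qed

lemma speed_eq:
  fixes t
  defines "x \<equiv> freq h * t - pi / 4"
  shows "(deriv (g_fun (- h) (1 / h)) t)\<^sup>2 + (g_fun (- h) (1 / h) t)\<^sup>2
    = speed_num x / (h * (freq h)\<^sup>2 * radial h x)"
  unfolding deriv_g_fun unfolding g_fun_eq x_def[symmetric] speed_num_def
  using h freq_pos[of h] radial_pos[of x]
  by (simp add: power_divide power_mult_distrib divide_simps) algebra

lemma theta_deriv:
  fixes t
  defines "x \<equiv> freq h * t - pi / 4"
  shows "(theta (- h) (1 / h) has_real_derivative
    - (h * freq h * sqrt (radial h x) * (radial h x + (freq h)\<^sup>2) / speed_num x)) (at t)"
proof -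
  let ?x = "\<lambda>t. freq h * t - pi / 4"
  have integrand: "sqrt (1 / h) * g_fun (- h) (1 / h) t * (- h - 1 / (g_fun (- h) (1 / h) t)\<^sup>2)
        / ((deriv (g_fun (- h) (1 / h)) t)\<^sup>2 + (g_fun (- h) (1 / h) t)\<^sup>2)
     = - (h * freq h * sqrt (radial h (?x t)) * (radial h (?x t) + (freq h)\<^sup>2) / speed_num (?x t))" for t
  proof -
    \<comment> \<open>With \<open>k\<close> and \<open>r\<close> standing for the square roots of
      \<open>h\<close> and of \<open>radial\<close>, the claim is an identity of rational
      functions.\<close>
    have *: "1 / k * (r / (k * w)) * (- (k\<^sup>2) - 1 / (r / (k * w))\<^sup>2) / (e / (k\<^sup>2 * w\<^sup>2 * r\<^sup>2))
        = - (k\<^sup>2 * w * r * (r\<^sup>2 + w\<^sup>2) / e)" if "k > 0" "r > 0" "w > 0" "e > 0" for k r w e :: real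
      using that by (simp add: divide_simps) algebra
    show ?thesis
      unfolding speed_eq unfolding g_fun_eq
      using *[of "sqrt h" "sqrt (radial h (?x t))" "freq h" "speed_num (?x t)"]
        h freq_pos[of h] radial_pos[of "?x t"] speed_num_pos[of "?x t"]
      by (simp add: real_sqrt_divide)
  qed
  have "isCont (\<lambda>t. - (h * freq h * sqrt (radial h (?x t)) * (radial h (?x t) + (freq h)\<^sup>2)
      / speed_num (?x t))) t" for t
    using speed_num_pos[of "?x t"]
    unfolding speed_num_def radial_def by (auto intro!: continuous_intros)
  then show ?thesis
    unfolding theta_def integrand x_def
    by (rule interval_integral_has_real_derivative)
qed

section \<open>The turning of the direction vector\<close>

lemma speed_num_deriv:
  "(speed_num has_real_derivative 2 * sin x * cos x * (h\<^sup>2 * (radial h x - (sin x)\<^sup>2) - (freq h)^4)) (at x)"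
proof -
  have "speed_num = (\<lambda>x. h\<^sup>2 * (sin x)\<^sup>2 * (h\<^sup>2 + (cos x)\<^sup>2) + (freq h)^4 * (cos x)\<^sup>2)"
    using speed_num_eq unfolding radial_def by auto
  then show ?thesis
    unfolding radial_def by (auto intro!: derivative_eq_intros simp: algebra_simps power2_eq_square)
qed

lemma sqrt_speed_num_deriv:
  "((\<lambda>x. sqrt (speed_num x)) has_real_derivative
    sin x * cos x * (h\<^sup>2 * (radial h x - (sin x)\<^sup>2) - (freq h)^4) / sqrt (speed_num x)) (at x)"
  by (rule DERIV_cong[OF DERIV_chain2[OF DERIV_real_sqrt[OF speed_num_pos] speed_num_deriv]])
    (simp add: divide_simps)

lemma sqrt_radial_deriv:
  "((\<lambda>x. sqrt (radial h x)) has_real_derivative - (sin x * cos x) / sqrt (radial h x)) (at x)"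
  using radial_pos[of x] unfolding radial_def
  by (auto intro!: derivative_eq_intros simp: divide_simps)

text \<open>The direction of the vector with components \<open>- sqrt C * g'\<close> and \<open>H * g\<^sup>2 + 1\<close>, divided by
  \<open>sin x\<close> so that it is also defined, and smooth, at the origin.\<close>

definition turn_cos :: "real \<Rightarrow> real" where
  "turn_cos x = (freq h)\<^sup>2 * cos x / sqrt (speed_num x)"

definition turn_sin :: "real \<Rightarrow> real" where
  "turn_sin x = h * sin x * sqrt (radial h x) / sqrt (speed_num x)"

definition arg_speed :: "real \<Rightarrow> real" where
  "arg_speed x = h * (freq h)\<^sup>2 * (radial h x - (cos x)\<^sup>2 * (sin x)\<^sup>2) / (sqrt (radial h x) * speed_num x)"

text \<open>Together with \<open>turn_sin_deriv\<close> this says that the unit vector with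
  components \<open>turn_cos\<close> and \<open>turn_sin\<close> turns with angular velocity
  \<open>arg_speed\<close>. The linear system avoids choosing a branch of the argument.\<close>

lemma turn_cos_deriv: "(turn_cos has_real_derivative - (arg_speed x * turn_sin x)) (at x)"
proof -
  define r e where "r = sqrt (radial h x)" and "e = sqrt (speed_num x)"
  have r: "r > 0" "radial h x = r\<^sup>2" and e: "e > 0" "speed_num x = e\<^sup>2"
    using radial_pos[of x] speed_num_pos[of x] by (auto simp: r_def e_def)
  have E: "e\<^sup>2 = h\<^sup>2 * (sin x)\<^sup>2 * r\<^sup>2 + (freq h)^4 * (cos x)\<^sup>2"
    using speed_num_eq[of x] unfolding r e .
  have sr: "sqrt (r\<^sup>2) = r" and se: "sqrt (e\<^sup>2) = e" using r e by simp_all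
  have sc: "(sin x)\<^sup>2 + (cos x)\<^sup>2 = 1" by simp
  define c s' w where "c = cos x" and "s' = sin x" and "w = freq h"
  note E = E[folded c_def s'_def w_def] and sc = sc[folded c_def s'_def]
  \<comment> \<open>The numerator left by the quotient rule: the \<open>w^4\<close> terms cancel by
    \<open>E\<close>, and \<open>sc\<close> combines the rest.\<close>
  have key: "s' * e\<^sup>2 + c * (s' * c * (h\<^sup>2 * (r\<^sup>2 - s'\<^sup>2) - w^4)) = h\<^sup>2 * s' * (r\<^sup>2 - c\<^sup>2 * s'\<^sup>2)"
    using E sc by algebra
  have "(w\<^sup>2 * - s' * e - s' * c * (h\<^sup>2 * (r\<^sup>2 - s'\<^sup>2) - w^4) / e * (w\<^sup>2 * c)) / (e * e)
      = - (w\<^sup>2 * (s' * e\<^sup>2 + c * (s' * c * (h\<^sup>2 * (r\<^sup>2 - s'\<^sup>2) - w^4))) / e ^ 3)"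
    using e(1) by (simp add: divide_simps) algebra
  also have "\<dots> = - (h * w\<^sup>2 * (r\<^sup>2 - c\<^sup>2 * s'\<^sup>2) / (r * e\<^sup>2) * (h * s' * r / e))"
    unfolding key using r(1) e(1) by (simp add: divide_simps) algebra
  finally have "(w\<^sup>2 * - s' * e - s' * c * (h\<^sup>2 * (r\<^sup>2 - s'\<^sup>2) - w^4) / e * (w\<^sup>2 * c)) / (e * e)
      = - (h * w\<^sup>2 * (r\<^sup>2 - c\<^sup>2 * s'\<^sup>2) / (r * e\<^sup>2) * (h * s' * r / e))" .
  then show ?thesis
    unfolding turn_cos_def[abs_def] turn_sin_def arg_speed_def
    by (intro DERIV_cong[OF DERIV_divide[OF DERIV_cmult[OF DERIV_cos] sqrt_speed_num_deriv]])
      (use r e in \<open>simp_all only: c_def[symmetric] s'_def[symmetric] w_def[symmetric] r(2) e(2) sr se,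
        simp_all add: ac_simps\<close>)
qed

lemma turn_sin_deriv: "(turn_sin has_real_derivative arg_speed x * turn_cos x) (at x)"
proof -
  define r e where "r = sqrt (radial h x)" and "e = sqrt (speed_num x)"
  have r: "r > 0" "radial h x = r\<^sup>2" and e: "e > 0" "speed_num x = e\<^sup>2"
    using radial_pos[of x] speed_num_pos[of x] by (auto simp: r_def e_def)
  have E: "e\<^sup>2 = h\<^sup>2 * (sin x)\<^sup>2 * r\<^sup>2 + (freq h)^4 * (cos x)\<^sup>2"
    using speed_num_eq[of x] unfolding r e .
  have sr: "sqrt (r\<^sup>2) = r" and se: "sqrt (e\<^sup>2) = e" using r e by simp_all
  have sc: "(sin x)\<^sup>2 + (cos x)\<^sup>2 = 1" by simp
  define c s' w where "c = cos x" and "s' = sin x" and "w = freq h"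
  note E = E[folded c_def s'_def w_def] and sc = sc[folded c_def s'_def]
  have key: "(c * r\<^sup>2 - s'\<^sup>2 * c) * e\<^sup>2 - s' * r\<^sup>2 * (s' * c * (h\<^sup>2 * (r\<^sup>2 - s'\<^sup>2) - w^4))
      = w^4 * c * (r\<^sup>2 - c\<^sup>2 * s'\<^sup>2)"
    using E sc by algebra
  have "((h * c * r + - (s' * c) / r * (h * s')) * e
        - s' * c * (h\<^sup>2 * (r\<^sup>2 - s'\<^sup>2) - w^4) / e * (h * s' * r)) / (e * e)
      = h * ((c * r\<^sup>2 - s'\<^sup>2 * c) * e\<^sup>2 - s' * r\<^sup>2 * (s' * c * (h\<^sup>2 * (r\<^sup>2 - s'\<^sup>2) - w^4)))
        / (r * e ^ 3)"
    using e(1) r(1) by (simp add: divide_simps) algebra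
  also have "\<dots> = h * w\<^sup>2 * (r\<^sup>2 - c\<^sup>2 * s'\<^sup>2) / (r * e\<^sup>2) * (w\<^sup>2 * c / e)"
    unfolding key using r(1) e(1) by (simp add: divide_simps) algebra
  finally have *: "((h * c * r + - (s' * c) / r * (h * s')) * e
        - (h * s' * r) * (s' * c * (h\<^sup>2 * (r\<^sup>2 - s'\<^sup>2) - w^4) / e)) / (e * e)
      = h * w\<^sup>2 * (r\<^sup>2 - c\<^sup>2 * s'\<^sup>2) / (r * e\<^sup>2) * (w\<^sup>2 * c / e)"
    by (simp only: mult.commute)
  then show ?thesis
    unfolding turn_sin_def[abs_def] turn_cos_def arg_speed_def
    by (intro DERIV_cong[OF DERIV_divide[OF DERIV_mult[OF DERIV_cmult[OF DERIV_sin] sqrt_radial_deriv]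
        sqrt_speed_num_deriv]])
      (use r e in \<open>simp_all only: c_def[symmetric] s'_def[symmetric] w_def[symmetric] r(2) e(2) sr se\<close>)
qed

text \<open>The argument of the turning vector, \<open>theta\<close> and \<open>angle\<close> have
  derivatives that sum to zero, and all three start at \<open>0\<close> at \<open>x = 0\<close>.
  Rotating the turning vector by \<open>theta\<close> therefore leaves the unit vector of argument
  \<open>- angle h x\<close>.\<close>

lemma angle_theta:
  fixes t
  defines "x \<equiv> freq h * t - pi / 4" and "\<theta> \<equiv> theta (- h) (1 / h) t"
  shows "turn_cos x * cos \<theta> - turn_sin x * sin \<theta> = cos (angle h x)"
    and "turn_cos x * sin \<theta> + turn_sin x * cos \<theta> = - sin (angle h x)"
proof -
  let ?x = "\<lambda>t. freq h * t - pi / 4"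
  define \<mu> where "\<mu> t = theta (- h) (1 / h) t + angle h (?x t)" for t
  have x_deriv: "(?x has_real_derivative freq h) (at t)" for t
    by (auto intro!: derivative_eq_intros)
  have mu_deriv: "(\<mu> has_real_derivative - freq h * arg_speed (?x t)) (at t)" for t
  proof -
    define r where "r = sqrt (radial h (?x t))"
    have r: "r > 0" "radial h (?x t) = r\<^sup>2"
      using radial_pos[of "?x t"] by (auto simp: r_def)
    define c s w E where "c = cos (?x t)" and "s = sin (?x t)" and "w = freq h" and "E = speed_num (?x t)"
    have E: "E > 0" "E = w\<^sup>2 * c\<^sup>2 * s\<^sup>2 + (r\<^sup>2)\<^sup>2"
      using speed_num_pos[of "?x t"] by (simp_all add: E_def speed_num_def c_def s_def w_def r)
    have q: "r\<^sup>2 = h\<^sup>2 + c\<^sup>2" "w\<^sup>2 = 1 + h\<^sup>2" "s\<^sup>2 + c\<^sup>2 = 1"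
      using r by (simp_all add: radial_def freq_sq c_def s_def w_def)
    \<comment> \<open>Over the common denominator \<open>r * E\<close>, this turns the sum of the
      derivatives of \<open>theta\<close> and of \<open>angle\<close> into
      \<open>- w * arg_speed\<close>.\<close>
    have "E - r\<^sup>2 * (r\<^sup>2 + w\<^sup>2) = - (w\<^sup>2 * (r\<^sup>2 - c\<^sup>2 * s\<^sup>2))"
      using E(2) q by algebra
    then have "- (h * w * r * (r\<^sup>2 + w\<^sup>2) / E) + h / r * w
        = - w * (h * w\<^sup>2 * (r\<^sup>2 - c\<^sup>2 * s\<^sup>2) / (r * E))"
      using r(1) E(1) by (simp add: divide_simps) algebra
    then show ?thesis
      unfolding \<mu>_def[abs_def] arg_speed_def
      by (intro DERIV_cong[OF DERIV_add[OF theta_deriv DERIV_chain2[OF angle_deriv x_deriv]]])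
        (simp add: r_def E_def c_def s_def w_def less_imp_le[OF radial_pos])
  qed
  \<comment> \<open>The components of the turning vector rotated by \<open>\<mu> t\<close>; the two
    angular velocities cancel, so both are constant.\<close>
  define U V where "U t = turn_cos (?x t) * cos (\<mu> t) - turn_sin (?x t) * sin (\<mu> t)"
    and "V t = turn_cos (?x t) * sin (\<mu> t) + turn_sin (?x t) * cos (\<mu> t)" for t
  note X = DERIV_chain2[OF turn_cos_deriv x_deriv] and Y = DERIV_chain2[OF turn_sin_deriv x_deriv]
  note cos = DERIV_chain2[OF DERIV_cos mu_deriv] and sin = DERIV_chain2[OF DERIV_sin mu_deriv]
  have "(U has_real_derivative 0) (at t)" for t
    unfolding U_def[abs_def]
    by (rule DERIV_cong[OF DERIV_diff[OF DERIV_mult[OF X cos] DERIV_mult[OF Y sin]]])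
      (simp add: algebra_simps)
  moreover have "(V has_real_derivative 0) (at t)" for t
    unfolding V_def[abs_def]
    by (rule DERIV_cong[OF DERIV_add[OF DERIV_mult[OF X sin] DERIV_mult[OF Y cos]]])
      (simp add: algebra_simps)
  moreover define t0 where "t0 = period (- h) / 4"
  ultimately have UV: "U t = U t0" "V t = V t0"
    using DERIV_isconst_all by blast+
  have x0: "?x t0 = 0"
    using freq_pos[of h] by (simp add: t0_def period_def freq_def)
  have mu0: "\<mu> t0 = 0"
    unfolding \<mu>_def x0 by (simp add: t0_def theta_def angle_0)
  have "sqrt (freq h ^ 4) = (freq h)\<^sup>2"
    using real_sqrt_abs[of "(freq h)\<^sup>2"] by simp
  then have "turn_cos 0 = 1" "turn_sin 0 = 0"
    using freq_pos[of h] by (simp_all add: turn_cos_def turn_sin_def speed_num_eq)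
  then have "U t0 = 1" "V t0 = 0"
    unfolding U_def V_def x0 mu0 by simp_all
  then have "turn_cos x * cos (\<mu> t) - turn_sin x * sin (\<mu> t) = 1"
      "turn_cos x * sin (\<mu> t) + turn_sin x * cos (\<mu> t) = 0"
    using UV by (simp_all add: U_def V_def x_def)
  \<comment> \<open>The vector rotated by \<open>\<mu> t\<close> is \<open>(1, 0)\<close>; rotating
    back by \<open>angle h x\<close> gives the claim.\<close>
  moreover have th: "\<theta> = \<mu> t - angle h x"
    by (simp add: \<mu>_def \<theta>_def x_def)
  have sc: "(sin (\<mu> t))\<^sup>2 + (cos (\<mu> t))\<^sup>2 = 1"
    by simp
  ultimately show "turn_cos x * cos \<theta> - turn_sin x * sin \<theta> = cos (angle h x)"
    and "turn_cos x * sin \<theta> + turn_sin x * cos \<theta> = - sin (angle h x)"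
    unfolding th cos_diff sin_diff by algebra+
qed

text \<open>The components \<open>- sqrt C * g'\<close> and \<open>H * g^2 + 1\<close>, after the
  normalization, are \<open>sin x / freq h\<close> times \<open>turn_cos\<close> and
  \<open>turn_sin\<close>, so \<open>angle_theta\<close> gives the direction.\<close>

lemma profile_eq:
  fixes t
  defines "x \<equiv> freq h * t - pi / 4"
  shows "profile (- h) (1 / h) t =
    (sin x / freq h) *\<^sub>R vector [cos (angle h x), sin (angle h x)]"
proof -
  define \<theta> where "\<theta> = theta (- h) (1 / h) t"
  define r where "r = sqrt (radial h x)"
  define e where "e = sqrt (speed_num x)"
  have r: "r > 0" "radial h x = r\<^sup>2" and e: "e > 0" "speed_num x = e\<^sup>2"
    using radial_pos[of x] h speed_num_pos[of x] by (auto simp: r_def e_def)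
  have D: "sqrt (1 / h * (deriv (g_fun (- h) (1 / h)) t)\<^sup>2 + 1 / h * (g_fun (- h) (1 / h) t)\<^sup>2)
      = e / (h * freq h * r)"
    unfolding distrib_left[symmetric] speed_eq x_def[symmetric] r(2) e(2)
    using h r(1) e(1) freq_pos[of h] by (simp add: real_sqrt_divide real_sqrt_mult)
  have A: "sqrt (1 / h) * deriv (g_fun (- h) (1 / h)) t = - (cos x * sin x) / (h * r)"
    unfolding deriv_g_fun x_def[symmetric] r_def[symmetric]
    using h by (simp add: real_sqrt_divide flip: real_sqrt_mult)
  have B: "- h * (g_fun (- h) (1 / h) t)\<^sup>2 + 1 = (sin x)\<^sup>2 / (freq h)\<^sup>2"
    unfolding g_fun_eq x_def[symmetric] using h freq_pos[of h] radial_pos[of x]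
    by (simp add: power_divide power_mult_distrib divide_simps)
       (simp add: freq_sq radial_def cos_squared_eq)
  note at = angle_theta[of t, folded x_def \<theta>_def, unfolded turn_cos_def turn_sin_def, folded r_def e_def]
  have field1: "(1 / (e / (h * w * r))) * (c * s / (h * r) * a - s\<^sup>2 / w\<^sup>2 * b)
      = s / w * (w\<^sup>2 * c / e * a - h * s * r / e * b)" if "w > 0" for c s w a b
    using that h r(1) e(1) by (simp add: divide_simps) algebra
  have field2: "(1 / (e / (h * w * r))) * (- (c * s / (h * r)) * a - s\<^sup>2 / w\<^sup>2 * b)
      = - (s / w * (w\<^sup>2 * c / e * a + h * s * r / e * b))" if "w > 0" for c s w a b
    using that h r(1) e(1) by (simp add: divide_simps) algebra
  have 1: "(1 / (e / (h * freq h * r))) * (cos x * sin x / (h * r) * cos \<theta>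
      - (sin x)\<^sup>2 / (freq h)\<^sup>2 * sin \<theta>) = sin x / freq h * cos (angle h x)"
    unfolding field1[OF freq_pos[of h]] at(1) ..
  have 2: "(1 / (e / (h * freq h * r))) * (- (cos x * sin x / (h * r)) * sin \<theta>
      - (sin x)\<^sup>2 / (freq h)\<^sup>2 * cos \<theta>) = sin x / freq h * sin (angle h x)"
    unfolding field2[OF freq_pos[of h]] at(2) by simp
  have A': "- sqrt (1 / h) * deriv (g_fun (- h) (1 / h)) t = cos x * sin x / (h * r)"
    using A by simp
  have "profile (- h) (1 / h) t = (1 / (e / (h * freq h * r))) *\<^sub>R
      vector [cos x * sin x / (h * r) * cos \<theta> - (sin x)\<^sup>2 / (freq h)\<^sup>2 * sin \<theta>,
        - (cos x * sin x) / (h * r) * sin \<theta> - (sin x)\<^sup>2 / (freq h)\<^sup>2 * cos \<theta>]"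
    unfolding profile_def Let_def \<theta>_def[symmetric] D A' unfolding A B ..
  also have "\<dots> = (sin x / freq h) *\<^sub>R vector [cos (angle h x), sin (angle h x)]"
    unfolding vec_eq_iff forall_2 vector_scaleR_component vector_2 real_scaleR_def
    using 1 2 by (metis minus_divide_left)
  finally show ?thesis .
qed

section \<open>The rotation angle over one period\<close>

text \<open>The integrand has period \<open>pi\<close>, because only the square of the cosine
  enters.\<close>

lemma angle_add_pi: "angle h (x + pi) = angle h x + angle h pi"
proof -
  have "((\<lambda>x. angle h (x + pi) - angle h x) has_real_derivative 0) (at x)" for x
    by (rule DERIV_cong[OF DERIV_diff[OF DERIV_shift[THEN iffD1, OF angle_deriv] angle_deriv]])
      (simp add: radial_def)
  then have "angle h (x + pi) - angle h x = angle h (0 + pi) - angle h 0"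
    by (intro DERIV_isconst_all[of "\<lambda>x. angle h (x + pi) - angle h x" x 0]) blast
  then show ?thesis
    by (simp add: angle_0)
qed

lemma sqrt_radial_le: "sqrt (radial h x) \<le> freq h"
  by (simp add: radial_def freq_def abs_square_le_1)

text \<open>The integrand is at least \<open>h / freq h\<close>. The bound gives positivity and, for
  large \<open>h\<close>, values close to \<open>pi\<close>.\<close>

lemma angle_pi_ge: "pi * (h / freq h) \<le> angle h pi"
proof -
  have "angle h 0 - 0 * (h / freq h) \<le> angle h pi - pi * (h / freq h)"
  proof (rule DERIV_nonneg_imp_nondecreasing[where f = "\<lambda>x. angle h x - x * (h / freq h)"])
    fix x
    have "h / sqrt (radial h x) - h / freq h \<ge> 0"
      using h sqrt_radial_le[of x] radial_pos[of x] by (simp add: frac_le freq_pos)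
    moreover have "((\<lambda>x. angle h x - x * (h / freq h)) has_real_derivative h / sqrt (radial h x) - h / freq h) (at x)"
      using freq_pos[of h] by (auto intro!: derivative_eq_intros angle_deriv h)
    ultimately show "\<exists>y. ((\<lambda>x. angle h x - x * (h / freq h)) has_real_derivative y) (at x) \<and> 0 \<le> y"
      by blast
  qed simp
  then show ?thesis
    by (simp add: angle_0)
qed

lemma angle_pi_less: "angle h pi < pi"
proof -
  have der: "((\<lambda>x. x - angle h x) has_real_derivative 1 - h / sqrt (radial h x)) (at x)" for x
    by (auto intro!: derivative_eq_intros angle_deriv h)
  have le: "h \<le> sqrt (radial h x)" for x
    by (rule real_le_rsqrt) (simp add: radial_def)
  \<comment> \<open>The integrand is at most \<open>1\<close>, with equality where the cosine
    vanishes. Strictness is gained on \<open>[0, pi / 4]\<close>, where the cosine is positive, and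
    the weak bound suffices on the rest.\<close>
  have "0 - angle h 0 < pi / 4 - angle h (pi / 4)"
  proof (rule DERIV_pos_imp_increasing[where f = "\<lambda>x. x - angle h x"])
    fix x :: real assume "0 \<le> x" "x \<le> pi / 4"
    then have "cos x > 0" by (intro cos_gt_zero_pi) (use pi_gt_zero in linarith)+
    then have "h < sqrt (radial h x)"
      by (intro real_less_rsqrt) (simp add: radial_def)
    then have "0 < 1 - h / sqrt (radial h x)"
      using radial_pos[of x] by simp
    then show "\<exists>y. ((\<lambda>x. x - angle h x) has_real_derivative y) (at x) \<and> 0 < y"
      using der by blast
  qed simp
  also have "pi / 4 - angle h (pi / 4) \<le> pi - angle h pi"
  proof (rule DERIV_nonneg_imp_nondecreasing[where f = "\<lambda>x. x - angle h x"])
    fix x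
    have "0 \<le> 1 - h / sqrt (radial h x)"
      using h le[of x] radial_pos[of x] by simp
    then show "\<exists>y. ((\<lambda>x. x - angle h x) has_real_derivative y) (at x) \<and> 0 \<le> y"
      using der by blast
  qed simp
  finally show ?thesis
    by (simp add: angle_0)
qed

lemma angle_pi_pos: "angle h pi > 0"
  using angle_pi_ge h freq_pos by (smt (verit) divide_pos_pos mult_pos_pos pi_gt_zero)

section \<open>The surface\<close>

lemma immersion_eq:
  fixes s t
  defines "x \<equiv> freq h * t - pi / 4"
  shows "immersion (- h) (1 / h) (s, t) =
    (1 / freq h) *\<^sub>R vector [sqrt (radial h x) * cos s, sqrt (radial h x) * sin s,
      sin x * cos (angle h x), sin x * sin (angle h x)]"
proof -
  have "(norm (profile (- h) (1 / h) t))\<^sup>2 = (sin x)\<^sup>2 / (freq h)\<^sup>2"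
    unfolding profile_eq x_def[symmetric] norm_eq_sqrt_inner inner_vec_def
    by (simp add: sum_2 power_mult_distrib power_divide flip: power2_eq_square distrib_left add_divide_distrib)
  then have "1 - (norm (profile (- h) (1 / h) t))\<^sup>2 = radial h x / (freq h)\<^sup>2"
    using freq_pos[of h] by (simp add: divide_simps) (simp add: freq_sq radial_def cos_squared_eq algebra_simps)
  then show ?thesis
    unfolding immersion_def
    using freq_pos[of h]
    by (simp add: real_sqrt_divide vec_eq_iff forall_4 vector_4 profile_eq x_def[symmetric])
qed

text \<open>With \<open>s = 0\<close>, the point is reached at both \<open>x = 0\<close> and
  \<open>x = pi\<close>. The directions are those of the circle through it and of the two passages
  of the profile curve.\<close>

lemma tangent_cone_directions:
  defines "M \<equiv> cmc_surface (- h) (1 / h)" and "K \<equiv> angle h pi"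
  shows "vector [1, 0, 0, 0] \<in> M"
    and "vector [0, 1, 0, 0] \<in> tangent_cone M (vector [1, 0, 0, 0])"
    and "(1 / freq h) *\<^sub>R vector [0, 0, 1, 0] \<in> tangent_cone M (vector [1, 0, 0, 0])"
    and "(- 1 / freq h) *\<^sub>R vector [0, 0, cos K, sin K] \<in> tangent_cone M (vector [1, 0, 0, 0])"
proof -
  have w: "freq h > 0" by (rule freq_pos)
  have q: "sqrt (radial h 0) = freq h" "sqrt (radial h pi) = freq h"
    by (simp_all add: radial_def freq_def)
  define \<phi> :: "real \<Rightarrow> real \<Rightarrow> real^4" where
    "\<phi> s x = (1 / freq h) *\<^sub>R vector [sqrt (radial h x) * cos s, sqrt (radial h x) * sin s,
      sin x * cos (angle h x), sin x * sin (angle h x)]" for s x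
  have \<phi>: "\<phi> s x \<in> M" for s x
  proof -
    have "\<phi> s x = immersion (- h) (1 / h) (s, (x + pi / 4) / freq h)"
      unfolding immersion_eq \<phi>_def using w by simp
    then show ?thesis
      unfolding M_def cmc_surface_def by blast
  qed
  have p: "\<phi> 0 0 = vector [1, 0, 0, 0]" "\<phi> 0 pi = vector [1, 0, 0, 0]"
    using w by (simp_all add: \<phi>_def q vec_eq_iff forall_4 vector_4 angle_0)
  show "vector [1, 0, 0, 0] \<in> M"
    using \<phi> p by metis
  have "((\<lambda>s. \<phi> s 0) has_vector_derivative vector [0, 1, 0, 0]) (at 0)"
  proof (rule has_vector_derivative_vecI)
    show "((\<lambda>s. \<phi> s 0 $ i) has_real_derivative vector [0, 1, 0, 0] $ i) (at 0)" for i
      using exhaust_4[of i] w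
      by (auto simp: \<phi>_def q vector_4 intro!: derivative_eq_intros)
  qed
  then show "vector [0, 1, 0, 0] \<in> tangent_cone M (vector [1, 0, 0, 0])"
    unfolding tangent_cone_def using p \<phi> by (intro CollectI exI[of _ "\<lambda>s. \<phi> s 0"]) auto
  \<comment> \<open>Where the sine vanishes, the radius \<open>sqrt (radial h x)\<close> is
    stationary and the derivative of \<open>angle\<close> is multiplied by zero. The factor
    \<open>cos a\<close> produces the minus sign at \<open>a = pi\<close>.\<close>
  have x_curve: "((\<lambda>x. \<phi> 0 (x + a)) has_vector_derivative
      (cos a / freq h) *\<^sub>R vector [0, 0, cos (angle h a), sin (angle h a)]) (at 0)"
    if "sin a = 0" for a
  proof (rule has_vector_derivative_vecI)
    have 1: "((\<lambda>x. sqrt (radial h x) / freq h) has_real_derivative 0) (at a)"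
      by (rule DERIV_cong[OF DERIV_cdivide[OF sqrt_radial_deriv]]) (simp add: that)
    have *: "((\<lambda>x. \<phi> 0 x $ i) has_real_derivative
      ((cos a / freq h) *\<^sub>R vector [0, 0, cos (angle h a), sin (angle h a)]) $ i) (at a)" for i
    proof (cases "i = 1")
      case True
      then show ?thesis using 1 by (simp add: \<phi>_def vector_4)
    next
      case False
      then show ?thesis
        using exhaust_4[of i] w that
        by (auto simp: \<phi>_def vector_4 intro!: derivative_eq_intros angle_deriv h)
    qed
    show "((\<lambda>x. \<phi> 0 (x + a) $ i) has_real_derivative
      ((cos a / freq h) *\<^sub>R vector [0, 0, cos (angle h a), sin (angle h a)]) $ i) (at 0)" for i
      using *[of i] DERIV_shift[of "\<lambda>x. \<phi> 0 x $ i" _ 0 a] by simp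
  qed
  show "(1 / freq h) *\<^sub>R vector [0, 0, 1, 0] \<in> tangent_cone M (vector [1, 0, 0, 0])"
    unfolding tangent_cone_def using x_curve[of 0] p \<phi> by (auto simp: angle_0)
  show "(- 1 / freq h) *\<^sub>R vector [0, 0, cos K, sin K] \<in> tangent_cone M (vector [1, 0, 0, 0])"
    unfolding tangent_cone_def K_def using x_curve[of pi] p \<phi>
    by (auto intro!: exI[of _ "\<lambda>x. \<phi> 0 (x + pi)"])
qed

lemma not_embedded: "\<not> embedded_in_S3 (- h) (1 / h)"
proof
  define M where "M = cmc_surface (- h) (1 / h)"
  define K where "K = angle h pi"
  define p :: "real^4" where "p = vector [1, 0, 0, 0]"
  note T = tangent_cone_directions[folded M_def K_def p_def]
  have "sin K > 0"
    using angle_pi_pos angle_pi_less by (simp add: K_def sin_gt_zero)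
  assume "embedded_in_S3 (- h) (1 / h)"
  then obtain w where w: "w \<bullet> p = 0" "w \<notin> span (tangent_cone M p)"
    using embedded_surface_normal_direction T(1) unfolding embedded_in_S3_def M_def by metis
  have "w $ 1 = 0"
    using w(1) by (simp add: p_def inner_vec_def sum_4 vector_4)
  \<comment> \<open>Since \<open>sin K\<close> is nonzero, the fourth component determines the
    coefficient of the second passage; the first passage then corrects the third component.\<close>
  then have "w = w $ 2 *\<^sub>R vector [0, 1, 0, 0]
      + (freq h * (w $ 3 - w $ 4 * cos K / sin K)) *\<^sub>R ((1 / freq h) *\<^sub>R vector [0, 0, 1, 0])
      + (- freq h * w $ 4 / sin K) *\<^sub>R ((- 1 / freq h) *\<^sub>R vector [0, 0, cos K, sin K])"
    using \<open>sin K > 0\<close> freq_pos[of h] by (simp add: vec_eq_iff forall_4 vector_4)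
  also have "\<dots> \<in> span (tangent_cone M p)"
    by (intro span_add span_scale span_base T)
  finally show False
    using w(2) by blast
qed

section \<open>The origin, the unit circle and the rotational symmetry\<close>

lemma zero_in_profile_curve: "0 \<in> profile_curve (- h) (1 / h)"
proof -
  \<comment> \<open>This is \<open>t = T / 4\<close>, that is, \<open>x = 0\<close>.\<close>
  have "profile (- h) (1 / h) (pi / 4 / freq h) = 0"
    unfolding profile_eq using freq_pos[of h] by simp
  then show ?thesis
    unfolding profile_curve_def by (metis rangeI)
qed

lemma unit_circle_in_surface: "\<exists>K. is_circle 1 K \<and> K \<subseteq> cmc_surface (- h) (1 / h)"
proof -
  let ?u = "axis 1 1 :: real^4" and ?v = "axis 2 1 :: real^4"
  have "0 + (1 * cos s) *\<^sub>R ?u + (1 * sin s) *\<^sub>R ?v = immersion (- h) (1 / h) (s, pi / 4 / freq h)" for s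
    unfolding immersion_eq using freq_pos[of h]
    by (simp add: vec_eq_iff forall_4 vector_4 axis_def radial_def freq_def add.commute)
  then have "range (\<lambda>s. 0 + (1 * cos s) *\<^sub>R ?u + (1 * sin s) *\<^sub>R ?v) \<subseteq> cmc_surface (- h) (1 / h)"
    unfolding cmc_surface_def by auto
  moreover have "is_circle 1 (range (\<lambda>s. 0 + (1 * cos s) *\<^sub>R ?u + (1 * sin s) *\<^sub>R ?v))"
    unfolding is_circle_def
    by (intro exI[of _ 0] exI[of _ ?u] exI[of _ ?v]) (simp add: inner_axis_axis)
  ultimately show ?thesis by blast
qed

text \<open>The factor \<open>sin x\<close> changes sign over a period, which accounts for the additional half turn.\<close>

lemma profile_shift:
  "profile (- h) (1 / h) (t + pi / freq h) = rotation (pi + angle h pi) (profile (- h) (1 / h) t)"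
proof -
  have *: "freq h * (t + pi / freq h) - pi / 4 = (freq h * t - pi / 4) + pi"
    using freq_pos[of h] by (simp add: distrib_left)
  define y where "y = freq h * t - pi / 4"
  show ?thesis
    unfolding profile_eq * y_def[symmetric] angle_add_pi sin_periodic_pi
    by (simp add: rotation_def vec_eq_iff forall_2 cos_add sin_add algebra_simps
        add_divide_distrib diff_divide_distrib)
qed

text \<open>Under the assumption, advancing by one period rotates by
  \<open>2 * pi - 2 * pi / m\<close>, so the rotation by \<open>2 * pi / m\<close> amounts to going
  back one period.\<close>

lemma profile_curve_invariant:
  assumes "angle h pi = pi - 2 * pi / real m"
  shows "invariant_under_Z m (profile_curve (- h) (1 / h))"
proof -
  let ?R = "rotation (2 * pi / real m)" and ?\<beta> = "profile (- h) (1 / h)"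
  have "?R (rotation (pi + (pi - 2 * pi / real m)) x) = x" for x
  proof -
    have [simp]: "cos (pi + (pi - a)) = cos a" "sin (pi + (pi - a)) = - sin a" for a :: real
      by simp_all
    have "(cos a)\<^sup>2 + (sin a)\<^sup>2 = 1" for a :: real by simp
    note sc = this[of "2 * pi / real m"]
    show ?thesis
      unfolding rotation_def vec_eq_iff forall_2 vector_2 using sc
      by (intro conjI; simp; algebra)
  qed
  then have R: "?R (?\<beta> (t + pi / freq h)) = ?\<beta> t" for t
    unfolding profile_shift assms by blast
  have "?R (?\<beta> t) \<in> range ?\<beta>" for t
    using R[of "t - pi / freq h"] by simp
  moreover have "?\<beta> t \<in> ?R ` range ?\<beta>" for t
    using R[of t] by (metis imageI rangeI)
  ultimately show ?thesis
    unfolding invariant_under_Z_def profile_curve_def by blast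
qed

text \<open>This passes from the oriented interval integral to the gauge integral, for which
  continuity in a parameter and dominated convergence are applied below.\<close>

lemma angle_pi_integral: "((\<lambda>v. h / sqrt (radial h v)) has_integral angle h pi) {0..pi}"
proof -
  have "((\<lambda>v. h / sqrt (radial h v)) has_integral angle h pi - angle h 0) {0..pi}"
    by (rule fundamental_theorem_of_calculus)
      (auto intro: DERIV_subset[OF angle_deriv]
        simp flip: has_real_derivative_iff_has_vector_derivative)
  then show ?thesis by (simp add: angle_0)
qed

end

section \<open>Dependence of the rotation angle on \<open>h\<close>\<close>

lemma continuous_on_angle_pi: "continuous_on {0<..} (\<lambda>h. angle h pi)"
proof -
  have "continuous_on ({0<..} \<times> cbox 0 pi) (\<lambda>(h, v). h / sqrt (radial h v))"
    unfolding case_prod_unfold radial_def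
    by (auto intro!: continuous_intros simp: add_pos_nonneg dest: add_nonneg_eq_0_iff[THEN iffD1, rotated 2])
  then have "continuous_on {0<..} (\<lambda>h. integral (cbox 0 pi) (\<lambda>v. h / sqrt (radial h v)))"
    by (rule integral_continuous_on_param)
  then show ?thesis
    using angle_pi_integral by (subst continuous_on_cong[OF refl]) (auto intro: integral_unique[symmetric])
qed

lemma angle_pi_tendsto_0: "(\<lambda>n. angle (1 / real (Suc n)) pi) \<longlonglongrightarrow> 0"
proof -
  let ?f = "\<lambda>n v. (1 / real (Suc n)) / sqrt (radial (1 / real (Suc n)) v)"
  \<comment> \<open>At \<open>pi / 2\<close> the cosine vanishes and the integrand is
    \<open>1\<close> for every \<open>n\<close>; elsewhere on \<open>[0, pi]\<close> it tends to
    \<open>0\<close>.\<close>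
  let ?g = "\<lambda>v. if v = pi / 2 then 1 else 0 :: real"
  have f: "(?f n has_integral angle (1 / real (Suc n)) pi) {0..pi}" for n
    by (rule angle_pi_integral) simp
  have "(\<lambda>n. integral {0..pi} (?f n)) \<longlonglongrightarrow> integral {0..pi} ?g"
  proof (rule dominated_convergence(2))
    show "?f n integrable_on {0..pi}" for n
      using f by blast
    show "(\<lambda>v. 1::real) integrable_on {0..pi}"
      by (rule integrable_on_const) simp
    show "norm (?f n v) \<le> 1" for n v
    proof -
      have "\<bar>a / sqrt (radial a v)\<bar> \<le> 1" if "a > 0" for a
      proof -
        have "a \<le> sqrt (radial a v)"
          by (rule real_le_rsqrt) (simp add: radial_def)
        then have "0 < sqrt (radial a v)" "a \<le> sqrt (radial a v)"
          using that by linarith+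
        then show ?thesis using that by (simp only: abs_of_pos divide_pos_pos divide_le_eq_1_pos)
      qed
      then show ?thesis
        by (metis divide_pos_pos of_nat_0_less_iff real_norm_def zero_less_Suc zero_less_one)
    qed
    fix v :: real assume v: "v \<in> {0..pi}"
    show "(\<lambda>n. ?f n v) \<longlonglongrightarrow> ?g v"
    proof (cases "v = pi / 2")
      case True
      then have "cos v = 0" by (simp only: cos_pi_half)
      then have "?f n v = ?g v" for n by (simp add: radial_def True)
      then show ?thesis by (simp only: tendsto_const)
    next
      case False
      then have "cos v \<noteq> 0"
        using v cos_inj_pi[of v "pi / 2"] by auto
      then have "(\<lambda>n. ?f n v) \<longlonglongrightarrow> 0 / sqrt (0\<^sup>2 + (cos v)\<^sup>2)"
        unfolding radial_def
        by (intro tendsto_intros lim_1_over_n[THEN LIMSEQ_Suc]) simp_all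
      then show ?thesis using False by simp
    qed
  qed
  moreover have "integral {0..pi} ?g = 0"
    by (rule integral_unique, rule has_integral_spike_finite[of "{pi / 2}" _ _ "\<lambda>_. 0"]) auto
  moreover have "integral {0..pi} (?f n) = angle (1 / real (Suc n)) pi" for n
    using f by (rule integral_unique)
  ultimately show ?thesis
    by (simp only:)
qed

lemma exists_angle_pi:
  assumes "m > (2::nat)"
  shows "\<exists>h>0. angle h pi = pi - 2 * pi / real m"
proof -
  have m: "real m > 2" using assms by simp
  have pos: "pi - 2 * pi / real m > 0"
    using m by (simp add: field_simps)
  obtain n where n: "angle (1 / real (Suc n)) pi < pi - 2 * pi / real m"
    using order_tendstoD(2)[OF angle_pi_tendsto_0 pos] by (auto dest: eventually_happens)
  \<comment> \<open>The ends for the intermediate value theorem: \<open>n\<close> was chosen so that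
    the value at \<open>a\<close> is too small, and \<open>b = m\<close> is large enough because
    \<open>m / (m + 1)\<close> is at least \<open>1 - 2 / m\<close>.\<close>
  define a b where "a = 1 / real (Suc n)" and "b = real m"
  have ab: "0 < a" "a \<le> b"
    using m order_trans[of a 1 b] by (simp_all add: a_def b_def)
  have "freq b \<le> b + 1"
    unfolding freq_def b_def by (rule real_le_lsqrt) (simp_all add: power2_eq_square algebra_simps)
  then have "b / (b + 1) \<le> b / freq b"
    using freq_pos[of b] m by (simp add: b_def frac_le)
  moreover have "1 - 2 / b \<le> b / (b + 1)"
    using m by (simp add: b_def field_simps)
  ultimately have "pi * (1 - 2 / b) \<le> pi * (b / freq b)"
    by (intro mult_left_mono) auto
  also have "\<dots> \<le> angle b pi"
    using angle_pi_ge[of b] m by (simp add: b_def)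
  finally have "pi - 2 * pi / real m \<le> angle b pi"
    by (simp add: b_def algebra_simps)
  moreover have "continuous_on {a..b} (\<lambda>h. angle h pi)"
    using ab by (intro continuous_on_subset[OF continuous_on_angle_pi]) auto
  ultimately obtain h where "a \<le> h" "h \<le> b" "angle h pi = pi - 2 * pi / real m"
    using IVT'[of "\<lambda>h. angle h pi" a "pi - 2 * pi / real m" b] n[folded a_def] ab by auto
  then show ?thesis
    using ab by (intro exI[of _ h]) simp
qed

theorem theorem6p1:
  shows "(\<forall>H::real. H < 0 \<longrightarrow> \<not> embedded_in_S3 H (- 1 / H)) \<and>
         (\<forall>H::real. H < 0 \<longrightarrow>
            0 \<in> profile_curve H (- 1 / H) \<and>
            (\<exists>K. is_circle 1 K \<and> K \<subseteq> cmc_surface H (- 1 / H))) \<and>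
         (\<forall>m::nat. m > 2 \<longrightarrow>
            (\<exists>H::real. H < 0 \<and> invariant_under_Z m (profile_curve H (- 1 / H))))"
proof (intro conjI allI impI)
  fix H :: real assume H: "H < 0"
  then have "- H > 0" by simp
  note facts = not_embedded[OF this] zero_in_profile_curve[OF this] unit_circle_in_surface[OF this]
  from facts show "\<not> embedded_in_S3 H (- 1 / H)" "0 \<in> profile_curve H (- 1 / H)"
    "\<exists>K. is_circle 1 K \<and> K \<subseteq> cmc_surface H (- 1 / H)"
    by simp_all
next
  fix m :: nat assume "m > 2"
  then obtain h where h: "h > 0" "angle h pi = pi - 2 * pi / real m"
    using exists_angle_pi by blast
  then have "invariant_under_Z m (profile_curve (- h) (- 1 / - h))"
    using profile_curve_invariant by simp
  then show "\<exists>H<0. invariant_under_Z m (profile_curve H (- 1 / H))"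
    using h(1) by (intro exI[of _ "- h"]) simp
qed

end
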